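(* Let $K$ be a field of characteristic zero and let $L_n$ be the free metabelian Leibniz algebra over $K$ on $x_1,\ldots,x_n$. Put $b_{ij}=[x_i,x_j]$ for $1\le i\ne j\le n$, and let $q=\sum_{1\le i\neq j\le n} b_{ij}q_{ij}\in L_n'$ with $q_{ij}\in K[R_n]=K[r_1,\ldots,r_n]$. Then $q$ is symmetric if and only if the following conditions hold: (i) for all $i\ne j$ and $k\neq l$ in $\{1,\ldots,n\}$ and every $\sigma\in S_n$ with $\sigma(i)=k$, $\sigma(j)=l$, one has $q_{kl}=\sigma q_{ij}$; in particular, $$q_{1i}=(2i)q_{12},\quad q_{i2}=(1i)q_{12},\quad q_{2i}=(1i)q_{21},\quad q_{i1}=(2i)q_{21},$$ $$q_{21}=(12)q_{12},\quad q_{ij}=(1i)(2j)q_{12},\qquad 3\le i\ne j\le n;$$ (ii) $q_{ij}=\pi q_{ij}$ for all $1\le i\ne j\le n$ and all $\pi\in\Pi_{ij}$.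
   Context: A Leibniz algebra over $K$ is a $K$-vector space with a bilinear bracket $[\cdot,\cdot]$ satisfying $[[x,y],z]=[[x,z],y]+[x,[y,z]]$ for all $x,y,z$. $L_n$ is the free algebra with free generators $X_n=\{x_1,\ldots,x_n\}$ in the variety of Leibniz algebras over $K$ satisfying the metabelian identity $[[x,y],[z,t]]=0$. $L_n'=[L_n,L_n]$ is its commutator ideal. $K[R_n]=K[r_1,\ldots,r_n]$ is the commutative polynomial algebra in $r_1,\ldots,r_n$, and $L_n'$ is a right $K[R_n]$-module via $u\,r_i=[u,x_i]$ for $u\in L_n'$ (these operators commute on $L_n'$ by the Leibniz and metabelian identities). The symmetric group $S_n$ acts on $L_n$ by algebra automorphisms with $\sigma x_i=x_{\sigma(i)}$, and on $K[R_n]$ by $\sigma f(r_1,\ldots,r_n)=f(r_{\sigma(1)},\ldots,r_{\sigma(n)})$. An element $s\in L_n$ is called symmetric if $\sigma s=s$ for all $\sigma\in S_n$. For $1\le i\ne j\le n$, $\Pi_{ij}=\{\pi\in S_n\mid \pi(i)=i,\ \pi(j)=j\}$. Here $(ab)\in S_n$ denotes a transposition. *)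

theory Defs
  imports Complex_Main "HOL-Library.Poly_Mapping" "HOL-Combinatorics.Permutations"
begin

section \<open>Linear extension\<close>

definition smul :: "'k::field \<Rightarrow> ('a \<Rightarrow>\<^sub>0 'k) \<Rightarrow> ('a \<Rightarrow>\<^sub>0 'k)" where
  "smul c p = Poly_Mapping.map ((*) c) p"

definition lin_ext :: "('k::field \<Rightarrow> 'v \<Rightarrow> 'v) \<Rightarrow> ('a \<Rightarrow> 'v) \<Rightarrow> ('a \<Rightarrow>\<^sub>0 'k) \<Rightarrow> 'v::ab_group_add" where
  "lin_ext scale f p = (\<Sum>m\<in>Poly_Mapping.keys p. scale (Poly_Mapping.lookup p m) (f m))"

lemma lookup_smul [simp]: "Poly_Mapping.lookup (smul c p) m = c * Poly_Mapping.lookup p m"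
  unfolding smul_def by transfer (auto simp: when_def)

lemma vector_space_smul: "vector_space (smul :: 'k::field \<Rightarrow> ('a \<Rightarrow>\<^sub>0 'k) \<Rightarrow> _)"
  by unfold_locales (auto intro!: poly_mapping_eqI simp: lookup_add algebra_simps)

context vector_space
begin

lemma lin_ext_superset:
  "finite A \<Longrightarrow> Poly_Mapping.keys p \<subseteq> A \<Longrightarrow>
    lin_ext scale f p = (\<Sum>m\<in>A. scale (Poly_Mapping.lookup p m) (f m))"
  unfolding lin_ext_def by (rule sum.mono_neutral_left) (auto simp: in_keys_iff)

lemma lin_ext_add: "lin_ext scale f (p + q) = lin_ext scale f p + lin_ext scale f q"
proof -
  let ?A = "Poly_Mapping.keys p \<union> Poly_Mapping.keys q"
  have "lin_ext scale f (p + q) = (\<Sum>m\<in>?A. scale (Poly_Mapping.lookup (p + q) m) (f m))"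
    by (rule lin_ext_superset) (auto simp: Poly_Mapping.keys_add)
  moreover have "lin_ext scale f p = (\<Sum>m\<in>?A. scale (Poly_Mapping.lookup p m) (f m))"
    by (rule lin_ext_superset) auto
  moreover have "lin_ext scale f q = (\<Sum>m\<in>?A. scale (Poly_Mapping.lookup q m) (f m))"
    by (rule lin_ext_superset) auto
  ultimately show ?thesis
    by (simp add: lookup_add scale_left_distrib sum.distrib)
qed

lemma lin_ext_smul: "lin_ext scale f (smul c p) = scale c (lin_ext scale f p)"
proof -
  have "lin_ext scale f (smul c p) =
      (\<Sum>m\<in>Poly_Mapping.keys p. scale (Poly_Mapping.lookup (smul c p) m) (f m))"
    by (rule lin_ext_superset) (auto simp: in_keys_iff)
  then show ?thesis by (simp add: lin_ext_def scale_sum_right)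
qed

lemma lin_ext_zero [simp]: "lin_ext scale f 0 = 0"
  by (simp add: lin_ext_def)

lemma lin_ext_diff: "lin_ext scale f (p - q) = lin_ext scale f p - lin_ext scale f q"
  using lin_ext_add[of f "p - q" q] by (simp add: algebra_simps)

lemma lin_ext_single [simp]: "lin_ext scale f (Poly_Mapping.single m c) = scale c (f m)"
  by (simp add: lin_ext_def)

lemma lin_ext_fun_add:
  "lin_ext scale (\<lambda>m. f m + g m) p = lin_ext scale f p + lin_ext scale g p"
  by (simp add: lin_ext_def scale_right_distrib sum.distrib)

lemma lin_ext_fun_scale: "lin_ext scale (\<lambda>m. scale c (f m)) p = scale c (lin_ext scale f p)"
  by (simp add: lin_ext_def scale_sum_right mult.commute)

lemma lin_ext_in_subspace:
  "subspace S \<Longrightarrow> (\<And>m. m \<in> Poly_Mapping.keys p \<Longrightarrow> f m \<in> S) \<Longrightarrow> lin_ext scale f p \<in> S"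
  by (auto simp: lin_ext_def intro!: subspace_sum subspace_scale)

end

lemma lin_ext_compose:
  assumes "\<And>a b. h (a + b) = h a + h b" "\<And>c a. h (s1 c a) = s2 c (h a)" "h 0 = 0"
  shows "h (lin_ext s1 f p) = lin_ext s2 (\<lambda>m. h (f m)) p"
proof -
  have "h (\<Sum>m\<in>A. s1 (Poly_Mapping.lookup p m) (f m)) = (\<Sum>m\<in>A. s2 (Poly_Mapping.lookup p m) (h (f m)))"
    if "finite A" for A using that by (induction A) (auto simp: assms)
  then show ?thesis by (simp add: lin_ext_def)
qed

lemma poly_mapping_lin_ext: "p = lin_ext smul (\<lambda>m. Poly_Mapping.single m 1) p"
proof (rule poly_mapping_eqI)
  fix k
  have "(\<Sum>m\<in>Poly_Mapping.keys p. Poly_Mapping.lookup p m * Poly_Mapping.lookup (Poly_Mapping.single m 1) k) =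
      (\<Sum>m\<in>Poly_Mapping.keys p. if m = k then Poly_Mapping.lookup p k else 0)"
    by (rule sum.cong) (auto simp: lookup_single)
  also have "\<dots> = Poly_Mapping.lookup p k" by (auto simp: in_keys_iff)
  finally show "Poly_Mapping.lookup p k = Poly_Mapping.lookup (lin_ext smul (\<lambda>m. Poly_Mapping.single m 1) p) k"
    by (simp add: lin_ext_def lookup_sum)
qed

section \<open>Metabelian Leibniz algebras\<close>

locale metabelian_leibniz_algebra = vector_space scale
  for scale :: "'k::field \<Rightarrow> 'v::ab_group_add \<Rightarrow> 'v" +
  fixes br :: "'v \<Rightarrow> 'v \<Rightarrow> 'v"
  assumes br_add_left: "br (a + b) c = br a c + br b c"
    and br_add_right: "br a (b + c) = br a b + br a c"
    and br_scale_left: "br (scale k a) b = scale k (br a b)"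
    and br_scale_right: "br a (scale k b) = scale k (br a b)"
    and leibniz: "br (br a b) c = br (br a c) b + br a (br b c)"
    and metabelian: "br (br a b) (br c d) = 0"
begin

lemmas leibniz_identity = leibniz

lemma br_zero_left [simp]: "br 0 a = 0"
  using br_add_left[of 0 0 a] by simp

lemma br_zero_right [simp]: "br a 0 = 0"
  using br_add_right[of a 0 0] by simp

lemma br_diff_left: "br (a - b) c = br a c - br b c"
  using br_add_left[of "a - b" b c] by (simp add: algebra_simps)

lemma br_diff_right: "br c (a - b) = br c a - br c b"
  using br_add_right[of c "a - b" b] by (simp add: algebra_simps)

end

section \<open>The free metabelian Leibniz algebra\<close>

text \<open>The free nonassociative algebra on \<open>x\<^sub>0, x\<^sub>1, \<dots>\<close> has the free magma as a basis; dividing by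
  the ideal generated by all values of the defining identities gives the free algebra
  of the variety on countably many generators. The algebra \<open>L\<^sub>n\<close> is its subalgebra generated by
  \<open>x\<^sub>1, \<dots>, x\<^sub>n\<close>; \<open>free_universal\<close> below shows that it is free on these generators.\<close>

datatype magma = Gen nat | Node magma magma

definition mprod :: "(magma \<Rightarrow>\<^sub>0 'k::field) \<Rightarrow> (magma \<Rightarrow>\<^sub>0 'k) \<Rightarrow> (magma \<Rightarrow>\<^sub>0 'k)" where
  "mprod p q = lin_ext smul (\<lambda>s. lin_ext smul (\<lambda>t. Poly_Mapping.single (Node s t) 1) q) p"

inductive_set mleib_ideal :: "(magma \<Rightarrow>\<^sub>0 'k::field) set" where
  zero: "0 \<in> mleib_ideal"
| add: "p \<in> mleib_ideal \<Longrightarrow> q \<in> mleib_ideal \<Longrightarrow> p + q \<in> mleib_ideal"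
| smul: "p \<in> mleib_ideal \<Longrightarrow> smul c p \<in> mleib_ideal"
| mprod_left: "p \<in> mleib_ideal \<Longrightarrow> mprod a p \<in> mleib_ideal"
| mprod_right: "p \<in> mleib_ideal \<Longrightarrow> mprod p a \<in> mleib_ideal"
| leibniz: "mprod (mprod a b) c - (mprod (mprod a c) b + mprod a (mprod b c)) \<in> mleib_ideal"
| metabelian: "mprod (mprod a b) (mprod c d) \<in> mleib_ideal"

global_interpretation smul: vector_space "smul :: 'k::field \<Rightarrow> ('a \<Rightarrow>\<^sub>0 'k) \<Rightarrow> _"
  by (rule vector_space_smul)

lemma mprod_add_left: "mprod (p + p') q = mprod p q + mprod p' q"
  by (simp add: mprod_def smul.lin_ext_add)

lemma mprod_add_right: "mprod p (q + q') = mprod p q + mprod p q'"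
  by (simp add: mprod_def smul.lin_ext_add smul.lin_ext_fun_add)

lemma mprod_smul_left: "mprod (smul c p) q = smul c (mprod p q)"
  by (simp add: mprod_def smul.lin_ext_smul)

lemma mprod_smul_right: "mprod p (smul c q) = smul c (mprod p q)"
  by (simp add: mprod_def smul.lin_ext_smul smul.lin_ext_fun_scale)

lemma mprod_diff_left: "mprod (p - p') q = mprod p q - mprod p' q"
  using mprod_add_left[of "p - p'" p' q] by (simp add: algebra_simps)

lemma mprod_diff_right: "mprod p (q - q') = mprod p q - mprod p q'"
  using mprod_add_right[of p "q - q'" q'] by (simp add: algebra_simps)

lemma mprod_single:
  "mprod (Poly_Mapping.single s 1) (Poly_Mapping.single t 1) = Poly_Mapping.single (Node s t) 1"
  by (simp add: mprod_def)

lemma mleib_ideal_uminus: "p \<in> mleib_ideal \<Longrightarrow> - p \<in> mleib_ideal"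
  using mleib_ideal.smul[of p "- 1"] by simp

lemma mleib_ideal_diff: "p \<in> mleib_ideal \<Longrightarrow> q \<in> mleib_ideal \<Longrightarrow> p - q \<in> mleib_ideal"
  using mleib_ideal.add[OF _ mleib_ideal_uminus] by fastforce

quotient_type (overloaded) 'k mleib = "magma \<Rightarrow>\<^sub>0 'k::field" / "\<lambda>p q. p - q \<in> mleib_ideal"
proof (rule equivpI)
  show "reflp (\<lambda>p q. p - q \<in> (mleib_ideal :: (magma \<Rightarrow>\<^sub>0 'k) set))"
    by (simp add: reflp_def mleib_ideal.zero)
  show "symp (\<lambda>p q. p - q \<in> (mleib_ideal :: (magma \<Rightarrow>\<^sub>0 'k) set))"
    unfolding symp_def using mleib_ideal_uminus by fastforce
  show "transp (\<lambda>p q. p - q \<in> (mleib_ideal :: (magma \<Rightarrow>\<^sub>0 'k) set))"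
    unfolding transp_def using mleib_ideal.add by fastforce
qed

instantiation mleib :: (field) ab_group_add
begin

lift_definition zero_mleib :: "'a mleib" is 0 .

lift_definition plus_mleib :: "'a mleib \<Rightarrow> 'a mleib \<Rightarrow> 'a mleib" is "(+)"
  by (metis add_diff_add mleib_ideal.add)

lift_definition minus_mleib :: "'a mleib \<Rightarrow> 'a mleib \<Rightarrow> 'a mleib" is "(-)"
  by (metis (no_types, lifting) diff_diff_eq2 add_diff_eq diff_add_eq diff_diff_add add.commute mleib_ideal_diff)

lift_definition uminus_mleib :: "'a mleib \<Rightarrow> 'a mleib" is uminus
  by (metis minus_diff_minus mleib_ideal_uminus)

instance
  by standard (transfer; simp add: algebra_simps mleib_ideal.zero)+

end

lift_definition mscale :: "'k::field \<Rightarrow> 'k mleib \<Rightarrow> 'k mleib" is smul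
  by (metis smul.scale_right_diff_distrib mleib_ideal.smul)

lift_definition lbr :: "'k::field mleib \<Rightarrow> 'k mleib \<Rightarrow> 'k mleib" is mprod
proof -
  fix p p' q q' :: "magma \<Rightarrow>\<^sub>0 'k"
  assume "p - p' \<in> mleib_ideal" "q - q' \<in> mleib_ideal"
  then have "mprod (p - p') q + mprod p' (q - q') \<in> mleib_ideal"
    by (intro mleib_ideal.add mleib_ideal.mprod_left mleib_ideal.mprod_right)
  then show "mprod p q - mprod p' q' \<in> mleib_ideal"
    by (simp add: mprod_diff_left mprod_diff_right)
qed

lift_definition gen :: "nat \<Rightarrow> 'k::field mleib" is "\<lambda>i. Poly_Mapping.single (Gen i) 1" .

global_interpretation mleib: metabelian_leibniz_algebra mscale "lbr :: 'k::field mleib \<Rightarrow> _"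
proof
  fix a b :: 'k and x y :: "'k mleib"
  show "mscale a (x + y) = mscale a x + mscale a y"
    by transfer (simp add: smul.scale_right_distrib mleib_ideal.zero)
  show "mscale (a + b) x = mscale a x + mscale b x"
    by transfer (simp add: smul.scale_left_distrib mleib_ideal.zero)
  show "mscale a (mscale b x) = mscale (a * b) x"
    by transfer (simp add: mleib_ideal.zero)
  show "mscale 1 x = x"
    by transfer (simp add: mleib_ideal.zero)
next
  fix k :: 'k and a b c d :: "'k mleib"
  show "lbr (a + b) c = lbr a c + lbr b c"
    by transfer (simp add: mprod_add_left mleib_ideal.zero)
  show "lbr a (b + c) = lbr a b + lbr a c"
    by transfer (simp add: mprod_add_right mleib_ideal.zero)
  show "lbr (mscale k a) b = mscale k (lbr a b)"
    by transfer (simp add: mprod_smul_left mleib_ideal.zero)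
  show "lbr a (mscale k b) = mscale k (lbr a b)"
    by transfer (simp add: mprod_smul_right mleib_ideal.zero)
  show "lbr (lbr a b) c = lbr (lbr a c) b + lbr a (lbr b c)"
    by transfer (rule mleib_ideal.leibniz)
  show "lbr (lbr a b) (lbr c d) = 0"
    by transfer (simp add: mleib_ideal.metabelian)
qed

inductive_set L :: "nat \<Rightarrow> 'k::field mleib set" for n where
  gen: "i \<in> {1..n} \<Longrightarrow> gen i \<in> L n"
| zero: "0 \<in> L n"
| add: "a \<in> L n \<Longrightarrow> b \<in> L n \<Longrightarrow> a + b \<in> L n"
| mscale: "a \<in> L n \<Longrightarrow> mscale c a \<in> L n"
| lbr: "a \<in> L n \<Longrightarrow> b \<in> L n \<Longrightarrow> lbr a b \<in> L n"

definition L' :: "nat \<Rightarrow> 'k::field mleib set" where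
  "L' n = mleib.span {lbr a b | a b. a \<in> L n \<and> b \<in> L n}"

subsection \<open>Homomorphisms defined on generators\<close>

primrec eval_magma :: "('v \<Rightarrow> 'v \<Rightarrow> 'v) \<Rightarrow> (nat \<Rightarrow> 'v) \<Rightarrow> magma \<Rightarrow> 'v" where
  "eval_magma br f (Gen i) = f i"
| "eval_magma br f (Node s t) = br (eval_magma br f s) (eval_magma br f t)"

text \<open>The homomorphism \<open>x\<^sub>i \<mapsto> f i\<close> into a metabelian Leibniz algebra; independence of the
  representative is \<open>induced_abs\<close>.\<close>

definition induced ::
  "('k::field \<Rightarrow> 'v \<Rightarrow> 'v) \<Rightarrow> ('v \<Rightarrow> 'v \<Rightarrow> 'v) \<Rightarrow> (nat \<Rightarrow> 'v) \<Rightarrow> 'k mleib \<Rightarrow> 'v::ab_group_add" where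
  "induced scale br f a = lin_ext scale (eval_magma br f) (rep_mleib a)"

context metabelian_leibniz_algebra
begin

lemma lin_ext_eval_mprod:
  "lin_ext scale (eval_magma br f) (mprod p q) =
    br (lin_ext scale (eval_magma br f) p) (lin_ext scale (eval_magma br f) q)"
proof -
  let ?H = "lin_ext scale (eval_magma br f)"
  have "?H (mprod p q) = lin_ext scale (\<lambda>s. lin_ext scale (\<lambda>t. br (eval_magma br f s) (eval_magma br f t)) q) p"
    unfolding mprod_def
    by (simp add: lin_ext_compose[where h = ?H and ?s1.0 = smul and ?s2.0 = scale] lin_ext_add lin_ext_smul)
  also have "\<dots> = lin_ext scale (\<lambda>s. br (eval_magma br f s) (?H q)) p"
    by (subst lin_ext_compose[where ?s1.0 = scale and ?s2.0 = scale])
      (simp_all add: br_add_right br_scale_right)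
  also have "\<dots> = br (?H p) (?H q)"
    by (rule lin_ext_compose[where h = "\<lambda>u. br u (?H q)", symmetric])
      (simp_all add: br_add_left br_scale_left)
  finally show ?thesis .
qed

lemma lin_ext_eval_ideal: "p \<in> mleib_ideal \<Longrightarrow> lin_ext scale (eval_magma br f) p = 0"
proof (induction p rule: mleib_ideal.induct)
  case (leibniz a b c)
  show ?case
    unfolding lin_ext_diff lin_ext_add lin_ext_eval_mprod
    by (subst leibniz_identity) simp
qed (simp_all add: lin_ext_add lin_ext_smul lin_ext_eval_mprod metabelian)

lemma induced_abs:
  "induced scale br f (abs_mleib p) = lin_ext scale (eval_magma br f) p"
proof -
  have "rep_mleib (abs_mleib p) - p \<in> mleib_ideal"
    using Quotient_rep_abs[OF Quotient_mleib, of p] by (simp add: mleib_ideal.zero)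
  from lin_ext_eval_ideal[OF this, of f] show ?thesis
    by (simp add: induced_def lin_ext_diff)
qed

lemma induced_add: "induced scale br f (a + b) = induced scale br f a + induced scale br f b"
  by (induct a rule: mleib.abs_induct, induct b rule: mleib.abs_induct)
    (simp add: plus_mleib.abs_eq induced_abs lin_ext_add)

lemma induced_scale: "induced scale br f (mscale c a) = scale c (induced scale br f a)"
  by (induct a rule: mleib.abs_induct) (simp add: mscale.abs_eq induced_abs lin_ext_smul)

lemma induced_br: "induced scale br f (lbr a b) = br (induced scale br f a) (induced scale br f b)"
  by (induct a rule: mleib.abs_induct, induct b rule: mleib.abs_induct)
    (simp add: lbr.abs_eq induced_abs lin_ext_eval_mprod)

lemma induced_gen [simp]: "induced scale br f (gen i) = f i"
  by (simp add: gen.abs_eq induced_abs)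

lemma induced_zero [simp]: "induced scale br f 0 = 0"
  using induced_add[of f 0 0] by simp

definition hom_from_L :: "nat \<Rightarrow> ('k mleib \<Rightarrow> 'v) \<Rightarrow> bool" where
  "hom_from_L n h \<longleftrightarrow> (\<forall>a\<in>L n. \<forall>b\<in>L n.
    h (a + b) = h a + h b \<and> h (lbr a b) = br (h a) (h b) \<and> (\<forall>c. h (mscale c a) = scale c (h a)))"

theorem free_universal:
  "\<exists>h. hom_from_L n h \<and> (\<forall>i\<in>{1..n}. h (gen i) = f i) \<and>
    (\<forall>h'. hom_from_L n h' \<and> (\<forall>i\<in>{1..n}. h' (gen i) = f i) \<longrightarrow> (\<forall>a\<in>L n. h' a = h a))"
proof (intro exI conjI allI impI ballI)
  show "hom_from_L n (induced scale br f)"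
    by (simp add: hom_from_L_def induced_add induced_br induced_scale)
  fix h' and a :: "'k mleib"
  assume h': "hom_from_L n h' \<and> (\<forall>i\<in>{1..n}. h' (gen i) = f i)" and a: "a \<in> L n"
  have "h' (0 + 0) = h' 0 + h' 0"
    using h' L.zero unfolding hom_from_L_def by blast
  then have "h' 0 = 0" by simp
  with a h' show "h' a = induced scale br f a"
    by (induction a rule: L.induct) (auto simp: hom_from_L_def induced_add induced_br induced_scale)
qed simp

end

section \<open>The action of the symmetric group\<close>

text \<open>The endomorphism with \<open>x\<^sub>i \<mapsto> x\<^bsub>\<sigma>(i)\<^esub>\<close>, which maps \<open>L\<^sub>n\<close> to itself if \<open>\<sigma>\<close> permutes
  \<open>{1..n}\<close> (\<open>perm_alg_L\<close>).\<close>

definition perm_alg :: "(nat \<Rightarrow> nat) \<Rightarrow> 'k::field mleib \<Rightarrow> 'k mleib" where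
  "perm_alg \<sigma> = induced mscale lbr (\<lambda>i. gen (\<sigma> i))"

lemma perm_alg_gen [simp]: "perm_alg \<sigma> (gen i) = gen (\<sigma> i)"
  and perm_alg_add: "perm_alg \<sigma> (a + b) = perm_alg \<sigma> a + perm_alg \<sigma> b"
  and perm_alg_mscale: "perm_alg \<sigma> (mscale c a) = mscale c (perm_alg \<sigma> a)"
  and perm_alg_lbr: "perm_alg \<sigma> (lbr a b) = lbr (perm_alg \<sigma> a) (perm_alg \<sigma> b)"
  and perm_alg_zero [simp]: "perm_alg \<sigma> 0 = 0"
  by (simp_all add: perm_alg_def mleib.induced_add mleib.induced_scale mleib.induced_br)

lemma perm_alg_L:
  assumes "\<sigma> permutes {1..n}" "a \<in> L n" shows "perm_alg \<sigma> a \<in> L n"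
  using assms(2)
proof (induction a rule: L.induct)
  case (gen i)
  then have "\<sigma> i \<in> {1..n}" using permutes_in_image[OF assms(1)] by blast
  then show ?case by (simp add: L.gen)
qed (auto simp: perm_alg_add perm_alg_mscale perm_alg_lbr intro: L.intros)

definition symmetric :: "nat \<Rightarrow> 'k::field mleib \<Rightarrow> bool" where
  "symmetric n s \<longleftrightarrow> s \<in> L n \<and> (\<forall>\<sigma>. \<sigma> permutes {1..n} \<longrightarrow> perm_alg \<sigma> s = s)"

section \<open>The polynomial algebra\<close>

type_synonym 'k rpoly = "(nat \<Rightarrow>\<^sub>0 nat) \<Rightarrow>\<^sub>0 'k"

definition rvar :: "nat \<Rightarrow> 'k::field rpoly" where
  "rvar i = Poly_Mapping.single (Poly_Mapping.single i 1) 1"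

definition KR :: "nat \<Rightarrow> 'k::field rpoly set" where
  "KR n = {f. \<forall>m\<in>Poly_Mapping.keys f. Poly_Mapping.keys m \<subseteq> {1..n}}"

text \<open>\<open>f(r\<^bsub>\<sigma>(1)\<^esub>, \<dots>, r\<^bsub>\<sigma>(n)\<^esub>)\<close>, by substitution of \<open>r\<^bsub>\<sigma>(i)\<^esub>\<close> for \<open>r\<^sub>i\<close> in every monomial.\<close>

definition perm_poly :: "(nat \<Rightarrow> nat) \<Rightarrow> 'k::field rpoly \<Rightarrow> 'k rpoly" where
  "perm_poly \<sigma> f = (\<Sum>m\<in>Poly_Mapping.keys f. Poly_Mapping.single 0 (Poly_Mapping.lookup f m) *
     (\<Prod>i\<in>Poly_Mapping.keys m. rvar (\<sigma> i) ^ Poly_Mapping.lookup m i))"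

lemma perm_poly_rvar: "perm_poly \<sigma> (rvar i) = rvar (\<sigma> i)"
  by (simp add: perm_poly_def rvar_def)

definition fixing_perms :: "nat \<Rightarrow> nat \<Rightarrow> nat \<Rightarrow> (nat \<Rightarrow> nat) set" where
  "fixing_perms n i j = {\<pi>. \<pi> permutes {1..n} \<and> \<pi> i = i \<and> \<pi> j = j}"

section \<open>The module structure on the commutator ideal\<close>

text \<open>A monomial acts by the right multiplications with its variables, applied in increasing
  order of the index; on the commutator ideal these operators commute (\<open>right_mult_commute\<close>),
  and \<open>module_act_mult\<close> shows that a module structure results.\<close>

definition monom_act :: "'k::field mleib \<Rightarrow> (nat \<Rightarrow>\<^sub>0 nat) \<Rightarrow> 'k mleib" where
  "monom_act u m = fold (\<lambda>i. (\<lambda>v. lbr v (gen i)) ^^ Poly_Mapping.lookup m i)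
     (sorted_list_of_set (Poly_Mapping.keys m)) u"

definition module_act :: "'k::field mleib \<Rightarrow> 'k rpoly \<Rightarrow> 'k mleib" where
  "module_act u f = lin_ext mscale (monom_act u) f"

lemma pm_induct [case_names zero add]:
  fixes p :: "'a \<Rightarrow>\<^sub>0 'b::comm_monoid_add"
  assumes "P 0" "\<And>p k c. P p \<Longrightarrow> P (p + Poly_Mapping.single k c)"
  shows "P p"
proof (induction p rule: update_induct)
  case const
  show ?case by (fact assms(1))
next
  case (update p a b)
  have "Poly_Mapping.update a b p = p + Poly_Mapping.single a b"
    using update(1) by (intro poly_mapping_eqI) (auto simp: lookup_update lookup_add lookup_single in_keys_iff)
  then show ?case using assms(2) update by simp
qed

lemma monom_induct [case_names one mult]:
  fixes m :: "nat \<Rightarrow>\<^sub>0 nat"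
  assumes "P 0" "\<And>m i. P m \<Longrightarrow> P (m + Poly_Mapping.single i 1)"
  shows "P m"
proof (induction m rule: pm_induct)
  case (add m k c)
  show ?case
  proof (induction c)
    case (Suc c)
    have "Poly_Mapping.single k (Suc c) = Poly_Mapping.single k c + Poly_Mapping.single k 1"
      by (simp flip: single_add)
    then show ?case using assms(2)[OF Suc] by (simp add: add.assoc)
  qed (simp add: add)
qed (fact assms(1))

definition brackets :: "'k::field mleib set" where
  "brackets = mleib.span {lbr a b | a b. True}"

lemma lbr_in_brackets: "lbr a b \<in> brackets"
  unfolding brackets_def by (rule mleib.span_base) auto

lemma brackets_induct [consumes 1, case_names zero step]:
  assumes "u \<in> brackets" "P 0" "\<And>c a b v. P v \<Longrightarrow> P (mscale c (lbr a b) + v)"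
  shows "P u"
  using assms(1) unfolding brackets_def
  by (rule mleib.span_induct_alt) (use assms(2,3) in auto)

lemma lbr_brackets_brackets:
  assumes "u \<in> brackets" "v \<in> brackets" shows "lbr u v = 0"
proof -
  have "lbr (lbr a b) v = 0" for a b
    using assms(2)
    by (induction v rule: brackets_induct)
      (auto simp: mleib.br_add_right mleib.br_scale_right mleib.metabelian)
  with assms(1) show ?thesis
    by (induction u rule: brackets_induct)
      (auto simp: mleib.br_add_left mleib.br_scale_left)
qed

lemma right_mult_commute: "u \<in> brackets \<Longrightarrow> lbr (lbr u a) b = lbr (lbr u b) a"
  using mleib.leibniz[of u a b] lbr_brackets_brackets[of u "lbr a b"] lbr_in_brackets[of a b] by simp

lemma subspace_L: "mleib.subspace (L n)"
  by (rule mleib.subspaceI) (auto intro: L.intros)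

lemma L'_subset_L: "L' n \<subseteq> L n"
  unfolding L'_def by (rule mleib.span_minimal[OF _ subspace_L]) (auto intro: L.intros)

lemma L'_subset_brackets: "L' n \<subseteq> brackets"
  unfolding L'_def brackets_def by (rule mleib.span_mono) auto

lemma subspace_L': "mleib.subspace (L' n)"
  unfolding L'_def by (rule mleib.subspace_span)

lemma lbr_in_L': "a \<in> L n \<Longrightarrow> b \<in> L n \<Longrightarrow> lbr a b \<in> L' n"
  unfolding L'_def by (rule mleib.span_base) auto

abbreviation rpow :: "nat \<Rightarrow> nat \<Rightarrow> 'k::field mleib \<Rightarrow> 'k mleib" where
  "rpow i k \<equiv> (\<lambda>v. lbr v (gen i)) ^^ k"

lemma rpow_brackets: "u \<in> brackets \<Longrightarrow> rpow i k u \<in> brackets"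
  by (cases k) (auto simp: lbr_in_brackets)

lemma rpow_lbr: "u \<in> brackets \<Longrightarrow> rpow i k (lbr u a) = lbr (rpow i k u) a"
  by (induction k) (auto simp: right_mult_commute rpow_brackets)

lemma fold_rpow_lbr:
  "u \<in> brackets \<Longrightarrow> fold (\<lambda>i. rpow i (f i)) xs (lbr u a) = lbr (fold (\<lambda>i. rpow i (f i)) xs u) a"
  by (induction xs arbitrary: u) (auto simp: rpow_lbr rpow_brackets)

lemma fold_rpow_filter:
  "fold (\<lambda>i. rpow i (f i)) (filter (\<lambda>i. f i \<noteq> 0) xs) u = fold (\<lambda>i. rpow i (f i)) xs u"
  by (induction xs arbitrary: u) auto

lemma fold_rpow_Suc:
  "u \<in> brackets \<Longrightarrow> distinct xs \<Longrightarrow> j \<in> set xs \<Longrightarrow>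
    fold (\<lambda>i. rpow i ((f(j := Suc (f j))) i)) xs u = lbr (fold (\<lambda>i. rpow i (f i)) xs u) (gen j)"
proof (induction xs arbitrary: u)
  case (Cons x xs)
  show ?case
  proof (cases "x = j")
    case True
    have "fold (\<lambda>i. rpow i ((f(j := Suc (f j))) i)) xs v = fold (\<lambda>i. rpow i (f i)) xs v" for v :: "'a mleib"
      by (rule fold_cong) (use Cons True in auto)
    with True show ?thesis using Cons.prems by (simp add: fold_rpow_lbr rpow_brackets)
  next
    case False
    then have "j \<in> set xs" using Cons.prems(3) by simp
    from Cons.IH[OF rpow_brackets[OF Cons.prems(1)] _ this] Cons.prems(2) False
    show ?thesis by simp
  qed
qed simp

lemma monom_act_superset:
  assumes "finite A" "Poly_Mapping.keys m \<subseteq> A"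
  shows "monom_act u m = fold (\<lambda>i. rpow i (Poly_Mapping.lookup m i)) (sorted_list_of_set A) u"
proof -
  have "filter (\<lambda>i. Poly_Mapping.lookup m i \<noteq> 0) (sorted_list_of_set A) = sorted_list_of_set (Poly_Mapping.keys m)"
    using assms by (intro sorted_distinct_set_unique) (auto simp: in_keys_iff sorted_wrt_filter)
  then show ?thesis
    using fold_rpow_filter[of "Poly_Mapping.lookup m" "sorted_list_of_set A" u]
    by (simp only: monom_act_def)
qed

lemma monom_act_one [simp]: "monom_act u 0 = u"
  by (simp add: monom_act_def)

lemma monom_act_single: "monom_act u (Poly_Mapping.single i 1) = lbr u (gen i)"
  by (simp add: monom_act_def)

lemma monom_act_Suc:
  assumes "u \<in> brackets"
  shows "monom_act u (m + Poly_Mapping.single j 1) = lbr (monom_act u m) (gen j)"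
proof -
  let ?A = "insert j (Poly_Mapping.keys m)" and ?m = "m + Poly_Mapping.single j 1"
  have "Poly_Mapping.lookup ?m = (Poly_Mapping.lookup m)(j := Suc (Poly_Mapping.lookup m j))"
    by (auto simp: lookup_add lookup_single fun_eq_iff)
  moreover have "monom_act u ?m = fold (\<lambda>i. rpow i (Poly_Mapping.lookup ?m i)) (sorted_list_of_set ?A) u"
    by (rule monom_act_superset) (auto simp: in_keys_iff lookup_add lookup_single when_def split: if_splits)
  moreover have "monom_act u m = fold (\<lambda>i. rpow i (Poly_Mapping.lookup m i)) (sorted_list_of_set ?A) u"
    by (rule monom_act_superset) auto
  ultimately show ?thesis
    using fold_rpow_Suc[OF assms distinct_sorted_list_of_set, of j ?A "Poly_Mapping.lookup m"]
    by (simp del: sorted_list_of_set_insert_remove)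
qed

lemma monom_act_brackets: "u \<in> brackets \<Longrightarrow> monom_act u m \<in> brackets"
  by (induction m rule: monom_induct) (auto simp: monom_act_Suc[unfolded One_nat_def] lbr_in_brackets)

lemma monom_act_mult:
  assumes "u \<in> brackets"
  shows "monom_act u (m + m') = monom_act (monom_act u m) m'"
proof (induction m' rule: monom_induct)
  case (mult m' i)
  have "monom_act u (m + (m' + Poly_Mapping.single i 1)) = lbr (monom_act u (m + m')) (gen i)"
    using monom_act_Suc[OF assms, of "m + m'" i] by (simp add: add.assoc)
  with mult show ?case by (simp add: monom_act_Suc[unfolded One_nat_def] monom_act_brackets assms)
qed simp

lemma monom_act_add: "monom_act (u + v) m = monom_act u m + monom_act v m"
  and monom_act_scale: "monom_act (mscale c u) m = mscale c (monom_act u m)"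
proof -
  have 1: "rpow i k (u + v) = rpow i k u + rpow i k v" for i k and u v :: "'a mleib"
    by (induction k) (auto simp: mleib.br_add_left)
  have 2: "rpow i k (mscale c u) = mscale c (rpow i k u)" for i k and u :: "'a mleib"
    by (induction k) (auto simp: mleib.br_scale_left)
  have "fold (\<lambda>i. rpow i (f i)) xs (u + v) = fold (\<lambda>i. rpow i (f i)) xs u + fold (\<lambda>i. rpow i (f i)) xs v"
    for f xs by (induction xs arbitrary: u v) (auto simp: 1)
  then show "monom_act (u + v) m = monom_act u m + monom_act v m"
    by (simp add: monom_act_def)
  have "fold (\<lambda>i. rpow i (f i)) xs (mscale c u) = mscale c (fold (\<lambda>i. rpow i (f i)) xs u)"
    for f xs by (induction xs arbitrary: u) (auto simp: 2)
  then show "monom_act (mscale c u) m = mscale c (monom_act u m)"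
    by (simp add: monom_act_def)
qed

lemma module_act_add_left: "module_act (u + v) f = module_act u f + module_act v f"
  by (simp add: module_act_def lin_ext_def monom_act_add mleib.scale_right_distrib sum.distrib)

lemma module_act_scale_left: "module_act (mscale c u) f = mscale c (module_act u f)"
  by (simp add: module_act_def lin_ext_def monom_act_scale mleib.scale_sum_right mult.commute)

lemma module_act_zero_left [simp]: "module_act 0 f = 0"
  using module_act_add_left[of 0 0 f] by simp

lemma module_act_zero [simp]: "module_act u 0 = 0"
  by (simp add: module_act_def)

lemma module_act_add: "module_act u (f + g) = module_act u f + module_act u g"
  by (simp add: module_act_def mleib.lin_ext_add)

lemma module_act_single: "module_act u (Poly_Mapping.single m c) = mscale c (monom_act u m)"
  by (simp add: module_act_def)

lemma module_act_one: "module_act u 1 = u"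
  using module_act_single[of u 0 1] by simp

lemma module_act_rvar: "module_act u (rvar i) = lbr u (gen i)"
  using module_act_single[of u "Poly_Mapping.single i 1" 1]
  by (simp add: rvar_def monom_act_single[unfolded One_nat_def])

lemma module_act_mult:
  assumes "u \<in> brackets"
  shows "module_act u (f * g) = module_act (module_act u f) g"
proof (induction f rule: pm_induct)
  case (add f m c)
  have "module_act u (Poly_Mapping.single m c * g) = module_act (module_act u (Poly_Mapping.single m c)) g"
  proof (induction g rule: pm_induct)
    case (add g m' c')
    show ?case
      by (simp add: distrib_left module_act_add add mult_single module_act_single monom_act_mult[OF assms]
          monom_act_scale mult.commute[of c c'])
  qed simp
  with add show ?case
    by (simp add: distrib_right module_act_add module_act_add_left)
qed simp

lemma module_act_L':
  assumes u: "u \<in> L' n" and f: "f \<in> KR n"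
  shows "module_act u f \<in> L' n"
proof -
  have *: "rpow i k v \<in> L' n" if "Suc 0 \<le> i" "i \<le> n" "v \<in> L' n" for i k and v :: "'a mleib"
    using that by (induction k) (auto intro!: lbr_in_L' L.gen dest: L'_subset_L[THEN subsetD])
  have "fold (\<lambda>i. rpow i (e i)) xs v \<in> L' n" if "set xs \<subseteq> {1..n}" "v \<in> L' n" for e xs and v :: "'a mleib"
    using that by (induction xs arbitrary: v) (auto intro!: *)
  then have "monom_act u m \<in> L' n" if "m \<in> Poly_Mapping.keys f" for m
    using that u f by (auto simp: monom_act_def KR_def)
  then show ?thesis
    unfolding module_act_def by (intro mleib.lin_ext_in_subspace subspace_L') auto
qed

end

theory Submission
  imports Defs "HOL-Library.Product_Plus"
begin

text \<open>A permutation \<open>\<sigma>\<close> sends \<open>b\<^sub>i\<^sub>j f\<close> to \<open>b\<^bsub>\<sigma>(i)\<sigma>(j)\<^esub> (\<sigma> f)\<close> (\<open>perm_alg_module_act\<close>), so it sends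
  \<open>q = \<Sum> b\<^sub>i\<^sub>j q\<^sub>i\<^sub>j\<close> to an element of the same shape, whose coefficient at \<open>b\<^bsub>\<sigma>(i)\<sigma>(j)\<^esub>\<close> is
  \<open>\<sigma> q\<^sub>i\<^sub>j\<close>. If coefficients are unique, \<open>\<sigma> q = q\<close> therefore says exactly that
  \<open>q\<^bsub>\<sigma>(i)\<sigma>(j)\<^esub> = \<sigma> q\<^sub>i\<^sub>j\<close> for all \<open>i \<noteq> j\<close>, which is condition (i); condition (ii) is its instance
  \<open>\<sigma>(i) = i\<close>, \<open>\<sigma>(j) = j\<close>, and the listed equalities are its instances at transpositions and at
  products of two of them.

  The substance is the uniqueness, that is, that the \<open>b\<^sub>i\<^sub>j\<close> are free generators over the polynomial
  algebra. It is obtained from a small metabelian Leibniz algebra for each pair \<open>(k, l)\<close>.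
  Row vectors \<open>(c, f)\<close> of polynomials form a right module over the Lie algebra of the matrices with
  rows \<open>(0, a)\<close> and \<open>(0, p)\<close>, whose Lie bracket is the commutator. The direct sum of the two
  spaces with the bracket \<open>[(v, A), (w, B)] = (v B, [A, B])\<close> is a Leibniz algebra, and it is metabelian
  because brackets have \<open>c = p = 0\<close>. Under the homomorphism \<open>x\<^sub>i \<mapsto> (\<delta>\<^sub>i\<^sub>k, 0, \<delta>\<^sub>i\<^sub>l, r\<^sub>i)\<close> the entry \<open>f\<close>
  of \<open>b\<^sub>i\<^sub>j\<close> is \<open>\<delta>\<^sub>i\<^sub>k \<delta>\<^sub>j\<^sub>l\<close>, and bracketing a commutator with \<open>x\<^sub>m\<close> multiplies this entry by \<open>r\<^sub>m\<close>. So
  this entry reads off the coefficient at \<open>b\<^sub>k\<^sub>l\<close> (\<open>coef_module_act\<close>).\<close>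

section \<open>Reading off the coefficients\<close>

type_synonym 'k quad = "'k rpoly \<times> 'k rpoly \<times> 'k rpoly \<times> 'k rpoly"

fun quad_scale :: "'k::field \<Rightarrow> 'k quad \<Rightarrow> 'k quad" where
  "quad_scale s (c, f, a, p) =
    (let s' = Poly_Mapping.single 0 s in (s' * c, s' * f, s' * a, s' * p))"

text \<open>In \<open>(c, f, a, p)\<close>, the row vector is \<open>(c, f)\<close> and the matrix has the rows \<open>(0, a)\<close> and
  \<open>(0, p)\<close>; the bracket pairs the product of row vector and matrix with the matrix commutator.\<close>

fun quad_br :: "'k::field quad \<Rightarrow> 'k quad \<Rightarrow> 'k quad" where
  "quad_br (c, f, a, p) (c', f', a', p') = (0, c * a' + f * p', a * p' - a' * p, 0)"

interpretation quad: metabelian_leibniz_algebra quad_scale "quad_br :: 'k::field quad \<Rightarrow> _"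
proof
  fix s t :: 'k and x y :: "'k quad"
  show "quad_scale s (x + y) = quad_scale s x + quad_scale s y"
    by (cases x; cases y) (simp add: algebra_simps Let_def)
  show "quad_scale (s + t) x = quad_scale s x + quad_scale t x"
    by (cases x) (simp add: algebra_simps Let_def single_add)
  show "quad_scale s (quad_scale t x) = quad_scale (s * t) x"
    by (cases x) (simp add: Let_def mult_single flip: mult.assoc)
  show "quad_scale 1 x = x"
    by (cases x) simp
next
  fix s :: 'k and a b c d :: "'k quad"
  show "quad_br (a + b) c = quad_br a c + quad_br b c"
    by (cases a; cases b; cases c) (simp add: algebra_simps)
  show "quad_br a (b + c) = quad_br a b + quad_br a c"
    by (cases a; cases b; cases c) (simp add: algebra_simps)
  show "quad_br (quad_scale s a) b = quad_scale s (quad_br a b)"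
    by (cases a; cases b) (simp add: algebra_simps Let_def)
  show "quad_br a (quad_scale s b) = quad_scale s (quad_br a b)"
    by (cases a; cases b) (simp add: algebra_simps Let_def)
  show "quad_br (quad_br a b) c = quad_br (quad_br a c) b + quad_br a (quad_br b c)"
    by (cases a; cases b; cases c) (simp add: algebra_simps)
  show "quad_br (quad_br a b) (quad_br c d) = 0"
    by (cases a; cases b; cases c; cases d) (simp add: zero_prod_def)
qed

definition quad_hom :: "nat \<Rightarrow> nat \<Rightarrow> 'k::field mleib \<Rightarrow> 'k quad" where
  "quad_hom k l = induced quad_scale quad_br (\<lambda>i. (of_bool (i = k), 0, of_bool (i = l), rvar i))"

definition coef :: "nat \<Rightarrow> nat \<Rightarrow> 'k::field mleib \<Rightarrow> 'k rpoly" where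
  "coef k l u = fst (snd (quad_hom k l u))"

lemma coef_zero [simp]: "coef k l 0 = 0"
  by (simp add: coef_def quad_hom_def)

lemma coef_add: "coef k l (u + v) = coef k l u + coef k l v"
  by (simp add: coef_def quad_hom_def quad.induced_add)

lemma coef_sum: "coef k l (\<Sum>x\<in>A. g x) = (\<Sum>x\<in>A. coef k l (g x))"
  by (induction A rule: infinite_finite_induct) (simp_all add: coef_add)

lemma coef_mscale: "coef k l (mscale s u) = Poly_Mapping.single 0 s * coef k l u"
  by (cases "quad_hom k l u") (simp add: coef_def quad_hom_def quad.induced_scale Let_def)

lemma coef_lbr_gen_gen: "coef k l (lbr (gen i) (gen j)) = of_bool (i = k \<and> j = l)"
  by (simp add: coef_def quad_hom_def quad.induced_br)

lemma fst_quad_hom_brackets: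
  assumes "u \<in> brackets" shows "fst (quad_hom k l u) = 0"
proof -
  have br: "fst (quad_br x y) = 0" for x y :: "'a quad"
    by (cases x; cases y) simp
  have scale: "fst (quad_scale s x) = Poly_Mapping.single 0 s * fst x" for s and x :: "'a quad"
    by (cases x) (simp add: Let_def)
  show ?thesis
    using assms
    by (induction u rule: brackets_induct)
      (simp_all add: quad_hom_def quad.induced_add quad.induced_scale quad.induced_br br scale)
qed

lemma coef_lbr_gen:
  assumes "u \<in> brackets" shows "coef k l (lbr u (gen i)) = coef k l u * rvar i"
  using fst_quad_hom_brackets[OF assms, of k l]
  by (cases "quad_hom k l u") (simp add: coef_def quad_hom_def quad.induced_br)

lemma coef_monom_act:
  assumes "u \<in> brackets" shows "coef k l (monom_act u m) = coef k l u * Poly_Mapping.single m 1"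
proof (induction m rule: monom_induct)
  case (mult m i)
  show ?case
    unfolding monom_act_Suc[OF assms] coef_lbr_gen[OF monom_act_brackets[OF assms]] mult rvar_def
    by (simp add: mult.assoc mult_single)
qed simp

text \<open>The coefficient maps are linear over the polynomial algebra, as the action on the row vectors
  with \<open>c = 0\<close> is multiplication by polynomials.\<close>

lemma coef_module_act:
  assumes "u \<in> brackets" shows "coef k l (module_act u f) = coef k l u * f"
proof (induction f rule: pm_induct)
  case (add f m s)
  have "Poly_Mapping.single 0 s * (coef k l u * Poly_Mapping.single m 1)
      = coef k l u * (Poly_Mapping.single 0 s * Poly_Mapping.single m 1)"
    by (rule mult.left_commute)
  also have "\<dots> = coef k l u * Poly_Mapping.single m s"
    by (simp add: mult_single)
  finally show ?case
    using add by (simp add: module_act_add coef_add module_act_single coef_mscale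
        coef_monom_act[OF assms] distrib_left)
qed simp

section \<open>Permuting variables and generators\<close>

definition perm_monom :: "(nat \<Rightarrow> nat) \<Rightarrow> (nat \<Rightarrow>\<^sub>0 nat) \<Rightarrow> 'k::field rpoly" where
  "perm_monom \<sigma> m = (\<Prod>i\<in>Poly_Mapping.keys m. rvar (\<sigma> i) ^ Poly_Mapping.lookup m i)"

lemma perm_monom_superset:
  assumes "finite A" "Poly_Mapping.keys m \<subseteq> A"
  shows "perm_monom \<sigma> m = (\<Prod>i\<in>A. rvar (\<sigma> i) ^ Poly_Mapping.lookup m i)"
  unfolding perm_monom_def using assms by (intro prod.mono_neutral_left) (auto simp: in_keys_iff)

lemma perm_monom_add: "perm_monom \<sigma> (m + m') = perm_monom \<sigma> m * perm_monom \<sigma> m'"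
proof -
  let ?A = "Poly_Mapping.keys m \<union> Poly_Mapping.keys m'"
  have "Poly_Mapping.keys (m + m') \<subseteq> ?A" by (rule Poly_Mapping.keys_add)
  then show ?thesis
    by (simp add: perm_monom_superset[of ?A] lookup_add power_add prod.distrib)
qed

lemma perm_monom_zero [simp]: "perm_monom \<sigma> 0 = 1"
  by (simp add: perm_monom_def)

lemma perm_monom_single: "perm_monom \<sigma> (Poly_Mapping.single i 1) = rvar (\<sigma> i)"
  by (simp add: perm_monom_def)

lemma perm_poly_superset:
  assumes "finite A" "Poly_Mapping.keys f \<subseteq> A"
  shows "perm_poly \<sigma> f = (\<Sum>m\<in>A. Poly_Mapping.single 0 (Poly_Mapping.lookup f m) * perm_monom \<sigma> m)"
  unfolding perm_poly_def perm_monom_def[symmetric]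
  using assms by (intro sum.mono_neutral_left) (auto simp: in_keys_iff)

lemma perm_poly_add: "perm_poly \<sigma> (f + g) = perm_poly \<sigma> f + perm_poly \<sigma> g"
proof -
  let ?A = "Poly_Mapping.keys f \<union> Poly_Mapping.keys g"
  have "Poly_Mapping.keys (f + g) \<subseteq> ?A" by (rule Poly_Mapping.keys_add)
  then show ?thesis
    by (simp add: perm_poly_superset[of ?A] lookup_add single_add distrib_right sum.distrib)
qed

lemma perm_poly_zero [simp]: "perm_poly \<sigma> 0 = 0"
  by (simp add: perm_poly_def)

lemma perm_poly_single: "perm_poly \<sigma> (Poly_Mapping.single m c) = Poly_Mapping.single 0 c * perm_monom \<sigma> m"
  by (simp add: perm_poly_superset[of "{m}"])

lemma perm_alg_sum: "perm_alg \<sigma> (\<Sum>x\<in>A. g x) = (\<Sum>x\<in>A. perm_alg \<sigma> (g x))"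
  by (induction A rule: infinite_finite_induct) (simp_all add: perm_alg_add)

lemma perm_alg_brackets: "u \<in> brackets \<Longrightarrow> perm_alg \<sigma> u \<in> brackets"
proof (induction u rule: brackets_induct)
  case zero
  show ?case by (simp add: brackets_def mleib.span_zero)
next
  case (step c a b v)
  have "mscale c (lbr (perm_alg \<sigma> a) (perm_alg \<sigma> b)) \<in> brackets"
    unfolding brackets_def by (rule mleib.span_scale, rule mleib.span_base) auto
  with step show ?case
    unfolding perm_alg_add perm_alg_mscale perm_alg_lbr brackets_def by (intro mleib.span_add)
qed

lemma perm_alg_monom_act:
  assumes "u \<in> brackets"
  shows "perm_alg \<sigma> (monom_act u m) = module_act (perm_alg \<sigma> u) (perm_monom \<sigma> m)"
proof (induction m rule: monom_induct)
  case (mult m i)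
  show ?case
    unfolding monom_act_Suc[OF assms] perm_monom_add perm_monom_single
      module_act_mult[OF perm_alg_brackets[OF assms]] module_act_rvar
    by (simp add: perm_alg_lbr mult)
qed (simp add: module_act_one)

text \<open>The algebra automorphism is semilinear, since it turns the right multiplication by \<open>x\<^sub>i\<close> into
  that by \<open>x\<^bsub>\<sigma>(i)\<^esub>\<close>.\<close>

lemma perm_alg_module_act:
  assumes "u \<in> brackets"
  shows "perm_alg \<sigma> (module_act u f) = module_act (perm_alg \<sigma> u) (perm_poly \<sigma> f)"
proof (induction f rule: pm_induct)
  case (add f m c)
  have "module_act (perm_alg \<sigma> u) (Poly_Mapping.single 0 c * perm_monom \<sigma> m)
      = mscale c (module_act (perm_alg \<sigma> u) (perm_monom \<sigma> m))"
    by (simp add: module_act_mult[OF perm_alg_brackets[OF assms]] module_act_single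
        module_act_scale_left)
  with add show ?case
    by (simp add: module_act_add perm_alg_add perm_poly_add perm_poly_single module_act_single
        perm_alg_mscale perm_alg_monom_act[OF assms])
qed simp

section \<open>Symmetric elements of the commutator ideal\<close>

abbreviation offdiag :: "nat \<Rightarrow> (nat \<times> nat) set" where
  "offdiag n \<equiv> {(i, j). i \<in> {1..n} \<and> j \<in> {1..n} \<and> i \<noteq> j}"

lemma finite_offdiag: "finite (offdiag n)"
  by (rule finite_subset[of _ "{1..n} \<times> {1..n}"]) auto

lemma bij_betw_offdiag:
  assumes "\<sigma> permutes {1..n}"
  shows "bij_betw (map_prod \<sigma> \<sigma>) (offdiag n) (offdiag n)"
proof (rule bij_betw_byWitness[where f' = "map_prod (inv \<sigma>) (inv \<sigma>)"])
  show "map_prod \<sigma> \<sigma> ` offdiag n \<subseteq> offdiag n"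
    using permutes_in_image[OF assms] permutes_inj[OF assms] by (auto dest: injD)
  show "map_prod (inv \<sigma>) (inv \<sigma>) ` offdiag n \<subseteq> offdiag n"
    using permutes_in_image[OF permutes_inv[OF assms]] permutes_inj[OF permutes_inv[OF assms]]
    by (auto dest: injD)
qed (auto simp: permutes_inverses[OF assms])

lemma coef_bracket_sum:
  assumes "(k, l) \<in> offdiag n"
  shows "coef k l (\<Sum>(i, j)\<in>offdiag n. module_act (lbr (gen i) (gen j)) (g i j)) = g k l"
proof -
  have "coef k l (\<Sum>(i, j)\<in>offdiag n. module_act (lbr (gen i) (gen j)) (g i j))
      = (\<Sum>x\<in>offdiag n. if x = (k, l) then g k l else 0)"
    unfolding coef_sum
    by (rule sum.cong) (auto simp: coef_module_act lbr_in_brackets coef_lbr_gen_gen)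
  also have "\<dots> = g k l"
    unfolding sum.delta[OF finite_offdiag] using assms by (rule if_P)
  finally show ?thesis .
qed

text \<open>Reindexing along \<open>\<sigma>\<close> brings the image back to the shape of a sum over the \<open>b\<^sub>i\<^sub>j\<close>, whose
  coefficients can then be compared with those of the original sum.\<close>

lemma perm_alg_bracket_sum:
  assumes "\<sigma> permutes {1..n}"
  shows "perm_alg \<sigma> (\<Sum>(i, j)\<in>offdiag n. module_act (lbr (gen i) (gen j)) (g i j))
    = (\<Sum>(i, j)\<in>offdiag n. module_act (lbr (gen i) (gen j)) (perm_poly \<sigma> (g (inv \<sigma> i) (inv \<sigma> j))))"
  unfolding perm_alg_sum
  by (subst sum.reindex_bij_betw[OF bij_betw_offdiag[OF assms], symmetric], rule sum.cong)
    (auto simp: perm_alg_module_act lbr_in_brackets perm_alg_lbr permutes_inverses[OF assms])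

lemma bracket_sum_in_L:
  assumes "\<And>i j. (i, j) \<in> offdiag n \<Longrightarrow> g i j \<in> KR n"
  shows "(\<Sum>(i, j)\<in>offdiag n. module_act (lbr (gen i) (gen j)) (g i j)) \<in> L n"
proof (rule mleib.subspace_sum[OF subspace_L])
  fix x assume "x \<in> offdiag n"
  with assms show "(case x of (i, j) \<Rightarrow> module_act (lbr (gen i) (gen j)) (g i j)) \<in> L n"
    by (auto intro!: L'_subset_L[THEN subsetD] module_act_L' lbr_in_L' L.gen)
qed

text \<open>By uniqueness, both sides of \<open>\<sigma> q = q\<close> may be compared coefficient by coefficient.\<close>

lemma symmetric_bracket_sum_iff:
  assumes coeffs: "\<And>i j. (i, j) \<in> offdiag n \<Longrightarrow> g i j \<in> KR n"
  shows "symmetric n (\<Sum>(i, j)\<in>offdiag n. module_act (lbr (gen i) (gen j)) (g i j)) \<longleftrightarrow>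
    (\<forall>\<sigma>. \<sigma> permutes {1..n} \<longrightarrow> (\<forall>(i, j)\<in>offdiag n. g (\<sigma> i) (\<sigma> j) = perm_poly \<sigma> (g i j)))"
    (is "symmetric n ?q \<longleftrightarrow> (\<forall>\<sigma>. _ \<longrightarrow> ?C \<sigma>)")
proof -
  have "perm_alg \<sigma> ?q = ?q \<longleftrightarrow> ?C \<sigma>" if \<sigma>: "\<sigma> permutes {1..n}" for \<sigma>
  proof
    assume fixed: "perm_alg \<sigma> ?q = ?q"
    show "?C \<sigma>"
    proof safe
      fix i j assume "i \<in> {1..n}" "j \<in> {1..n}" "i \<noteq> j"
      then have "(\<sigma> i, \<sigma> j) \<in> offdiag n"
        using bij_betwE[OF bij_betw_offdiag[OF \<sigma>]] by fastforce
      from arg_cong[OF fixed, of "coef (\<sigma> i) (\<sigma> j)"] show "g (\<sigma> i) (\<sigma> j) = perm_poly \<sigma> (g i j)"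
        unfolding perm_alg_bracket_sum[OF \<sigma>] coef_bracket_sum[OF \<open>(\<sigma> i, \<sigma> j) \<in> offdiag n\<close>]
        by (simp add: permutes_inverses[OF \<sigma>])
    qed
  next
    assume C: "?C \<sigma>"
    have "perm_poly \<sigma> (g (inv \<sigma> i) (inv \<sigma> j)) = g i j" if "(i, j) \<in> offdiag n" for i j
    proof -
      have "(inv \<sigma> i, inv \<sigma> j) \<in> offdiag n"
        using bij_betwE[OF bij_betw_offdiag[OF permutes_inv[OF \<sigma>]]] that by fastforce
      with C have "g (\<sigma> (inv \<sigma> i)) (\<sigma> (inv \<sigma> j)) = perm_poly \<sigma> (g (inv \<sigma> i) (inv \<sigma> j))" by blast
      then show ?thesis by (simp add: permutes_inverses[OF \<sigma>])
    qed
    then show "perm_alg \<sigma> ?q = ?q"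
      unfolding perm_alg_bracket_sum[OF \<sigma>] by (intro sum.cong) auto
  qed
  then show ?thesis
    using bracket_sum_in_L[of n g] coeffs by (auto simp: symmetric_def)
qed

theorem theorem2p2:
  fixes n :: nat
    and qc :: "nat \<Rightarrow> nat \<Rightarrow> ('k :: field_char_0) rpoly"
    and q :: "'k mleib"
  assumes coeffs: "\<And>i j. i \<in> {1..n} \<Longrightarrow> j \<in> {1..n} \<Longrightarrow> i \<noteq> j \<Longrightarrow> qc i j \<in> KR n"
    and q_eq: "q = (\<Sum>(i, j) \<in> {(i, j). i \<in> {1..n} \<and> j \<in> {1..n} \<and> i \<noteq> j}.
                      module_act (lbr (gen i) (gen j)) (qc i j))"
  shows
    "(symmetric n q \<longleftrightarrow>
        (\<forall>i\<in>{1..n}. \<forall>j\<in>{1..n}. \<forall>k\<in>{1..n}. \<forall>l\<in>{1..n}. \<forall>\<sigma>.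
           i \<noteq> j \<and> k \<noteq> l \<and> \<sigma> permutes {1..n} \<and> \<sigma> i = k \<and> \<sigma> j = l
             \<longrightarrow> qc k l = perm_poly \<sigma> (qc i j)) \<and>
        (\<forall>i\<in>{1..n}. \<forall>j\<in>{1..n}. i \<noteq> j \<longrightarrow>
           (\<forall>\<pi>\<in>fixing_perms n i j. qc i j = perm_poly \<pi> (qc i j)))) \<and>
     ((\<forall>i\<in>{1..n}. \<forall>j\<in>{1..n}. \<forall>k\<in>{1..n}. \<forall>l\<in>{1..n}. \<forall>\<sigma>.
           i \<noteq> j \<and> k \<noteq> l \<and> \<sigma> permutes {1..n} \<and> \<sigma> i = k \<and> \<sigma> j = l
             \<longrightarrow> qc k l = perm_poly \<sigma> (qc i j))
        \<longrightarrow>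
        (\<forall>i\<in>{3..n}.
           qc 1 i = perm_poly (transpose 2 i) (qc 1 2) \<and>
           qc i 2 = perm_poly (transpose 1 i) (qc 1 2) \<and>
           qc 2 i = perm_poly (transpose 1 i) (qc 2 1) \<and>
           qc i 1 = perm_poly (transpose 2 i) (qc 2 1)) \<and>
        (2 \<le> n \<longrightarrow> qc 2 1 = perm_poly (transpose 1 2) (qc 1 2)) \<and>
        (\<forall>i\<in>{3..n}. \<forall>j\<in>{3..n}. i \<noteq> j \<longrightarrow>
           qc i j = perm_poly (transpose 1 i \<circ> transpose 2 j) (qc 1 2)))"
proof (intro conjI impI)
  have "symmetric n q \<longleftrightarrow>
      (\<forall>\<sigma>. \<sigma> permutes {1..n} \<longrightarrow> (\<forall>(i, j)\<in>offdiag n. qc (\<sigma> i) (\<sigma> j) = perm_poly \<sigma> (qc i j)))"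
    unfolding q_eq by (rule symmetric_bracket_sum_iff) (use coeffs in auto)
  also have "\<dots> \<longleftrightarrow>
      (\<forall>i\<in>{1..n}. \<forall>j\<in>{1..n}. \<forall>k\<in>{1..n}. \<forall>l\<in>{1..n}. \<forall>\<sigma>.
         i \<noteq> j \<and> k \<noteq> l \<and> \<sigma> permutes {1..n} \<and> \<sigma> i = k \<and> \<sigma> j = l
           \<longrightarrow> qc k l = perm_poly \<sigma> (qc i j)) \<and>
      (\<forall>i\<in>{1..n}. \<forall>j\<in>{1..n}. i \<noteq> j \<longrightarrow>
         (\<forall>\<pi>\<in>fixing_perms n i j. qc i j = perm_poly \<pi> (qc i j)))" (is "?E \<longleftrightarrow> ?R")
  proof
    assume E: ?E
    have "qc (\<sigma> i) (\<sigma> j) = perm_poly \<sigma> (qc i j)"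
      if "\<sigma> permutes {1..n}" "i \<in> {1..n}" "j \<in> {1..n}" "i \<noteq> j" for \<sigma> i j
      using E that by blast
    then show ?R
      unfolding fixing_perms_def by (smt (verit) mem_Collect_eq)
  next
    assume R: ?R
    show ?E
    proof (intro allI impI, safe)
      fix \<sigma> i j assume \<sigma>: "\<sigma> permutes {1..n}" and ij: "i \<in> {1..n}" "j \<in> {1..n}" "i \<noteq> j"
      then have "\<sigma> i \<in> {1..n}" "\<sigma> j \<in> {1..n}" "\<sigma> i \<noteq> \<sigma> j"
        using permutes_in_image[OF \<sigma>] permutes_inj[OF \<sigma>] by (auto dest: injD)
      with R \<sigma> ij show "qc (\<sigma> i) (\<sigma> j) = perm_poly \<sigma> (qc i j)" by blast
    qed
  qed
  finally show "symmetric n q \<longleftrightarrow> ?R" .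
next
  assume i: "\<forall>i\<in>{1..n}. \<forall>j\<in>{1..n}. \<forall>k\<in>{1..n}. \<forall>l\<in>{1..n}. \<forall>\<sigma>.
         i \<noteq> j \<and> k \<noteq> l \<and> \<sigma> permutes {1..n} \<and> \<sigma> i = k \<and> \<sigma> j = l
           \<longrightarrow> qc k l = perm_poly \<sigma> (qc i j)"
  have eq: "qc k l = perm_poly \<sigma> (qc i j)"
    if "\<sigma> permutes {1..n}" "\<sigma> i = k" "\<sigma> j = l" "i \<in> {1..n}" "j \<in> {1..n}" "i \<noteq> j" for \<sigma> i j k l
  proof -
    have "k \<in> {1..n}" "l \<in> {1..n}" "k \<noteq> l"
      using that permutes_in_image[OF that(1)] permutes_inj[OF that(1)] by (auto dest: injD)
    with i that show ?thesis by blast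
  qed
  show "\<forall>i\<in>{3..n}.
      qc 1 i = perm_poly (transpose 2 i) (qc 1 2) \<and>
      qc i 2 = perm_poly (transpose 1 i) (qc 1 2) \<and>
      qc 2 i = perm_poly (transpose 1 i) (qc 2 1) \<and>
      qc i 1 = perm_poly (transpose 2 i) (qc 2 1)"
    by (intro ballI conjI eq permutes_swap_id) (auto simp: transpose_def)
  show "qc 2 1 = perm_poly (transpose 1 2) (qc 1 2)" if "2 \<le> n"
    using that by (intro eq permutes_swap_id) auto
  show "\<forall>i\<in>{3..n}. \<forall>j\<in>{3..n}. i \<noteq> j \<longrightarrow>
      qc i j = perm_poly (transpose 1 i \<circ> transpose 2 j) (qc 1 2)"
    by (intro ballI impI eq permutes_compose permutes_swap_id) (auto simp: transpose_def)
qed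

end
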